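(* Let $X$ be a real topological vector space whose dual $X^*$ separates points on $X$. Let $f:[0,\infty)\to X$ be non-zero (i.e. $f\not\equiv\mathbf 0$) and such that for every $x^*\in X^*$ the function $x^*\circ f:[0,\infty)\to\mathbb R$ is right continuous at some point of $[0,\infty)$ (the point may depend on $x^*$), and let $g:[0,\infty)\to[0,\infty)$. Then $$f(s+g(s)t)=f(s)+f(t)\qquad\text{for all } s,t\in[0,\infty)$$ if and only if one of the following holds: 1. there is $\mathbf a\in X\setminus\{\mathbf 0\}$ such that $f(s)=s\,\mathbf a$ for all $s\in[0,\infty)$, and $g\equiv 1$; 2. there are $\alpha>0$ and $\mathbf a\in X\setminus\{\mathbf 0\}$ such that $f(s)=\log(\alpha s+1)\,\mathbf a$ and $g(s)=\alpha s+1$ for all $s\in[0,\infty)$.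
   Context: $X^*$ denotes the (topological) dual of $X$, i.e. the space of continuous linear functionals $X\to\mathbb R$. It separates points on $X$ if for every $\mathbf x\in X\setminus\{\mathbf 0\}$ there exists $x^*\in X^*$ with $x^*\mathbf x\neq 0$. *)

theory Defs
  imports "HOL-Analysis.Analysis"
begin

(* No Hausdorff axiom: it is not part of the definition of a topological vector space. *)
class real_topological_vector = real_vector + topological_ab_group_add +
  assumes tendsto_scaleR_Pair:
    "LIM x (nhds r \<times>\<^sub>F nhds a). fst x *\<^sub>R snd x :> nhds (r *\<^sub>R a)"

instance real_normed_vector \<subseteq> real_topological_vector
proof
  fix r :: real and a :: 'a
  have "((\<lambda>x. fst x *\<^sub>R snd x) \<longlongrightarrow> fst (r, a) *\<^sub>R snd (r, a)) (nhds (r, a))"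
    by (intro tendsto_scaleR tendsto_fst tendsto_snd filterlim_ident)
  then show "LIM x (nhds r \<times>\<^sub>F nhds a). fst x *\<^sub>R snd x :> nhds (r *\<^sub>R a)"
    by (simp add: nhds_prod)
qed

definition topological_dual :: "('a::real_topological_vector \<Rightarrow> real) set" where
  "topological_dual = {\<phi>. linear \<phi> \<and> continuous_on UNIV \<phi>}"

definition separates_points :: "('a::real_topological_vector \<Rightarrow> real) set \<Rightarrow> bool" where
  "separates_points D \<longleftrightarrow> (\<forall>x. x \<noteq> 0 \<longrightarrow> (\<exists>\<phi>\<in>D. \<phi> x \<noteq> 0))"

end

theory Submission
  imports Defs
begin

text \<open>
  Pairing with a functional reduces everything to a scalar \<open>h \<noteq> 0\<close> satisfying the same equation.
  Right continuity at one point spreads to \<open>0\<close>. If \<open>g s < 1\<close>, the contraction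
  \<open>t \<mapsto> s + g s * t\<close> has a fixed point \<open>c\<close>, where the equation forces \<open>h s = 0\<close>; hence \<open>h\<close> is
  invariant under the contraction, so constant on \<open>[c, \<infinity>)\<close>, so zero. Thus \<open>g \<ge> 1\<close>, and
  \<open>h u - h s = h ((u - s) / g s)\<close> for \<open>s \<le> u\<close> makes \<open>h\<close> uniformly continuous. A zero \<open>s > 0\<close> of \<open>h\<close>
  would give \<open>h [0, \<infinity>) = h [0, s]\<close>, which is bounded, whereas the range of \<open>h\<close> is closed under
  addition. So \<open>h\<close> is injective, and the symmetry of \<open>h s + h t\<close> yields
  \<open>s + g s * t = t + g t * s\<close>, i.e. \<open>g s = 1 + \<alpha> * s\<close>. The substitution
  \<open>s = (exp x - 1) / \<alpha>\<close> turns the case \<open>\<alpha> > 0\<close> into Cauchy's equation.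
\<close>

section \<open>The scalar equation: regularity, injectivity and the form of g\<close>

locale goldie =
  fixes h g :: "real \<Rightarrow> real"
  assumes goldie: "\<lbrakk>s \<ge> 0; t \<ge> 0\<rbrakk> \<Longrightarrow> h (s + g s * t) = h s + h t"
    and g_nonneg: "s \<ge> 0 \<Longrightarrow> g s \<ge> 0"
    and right_continuous: "\<exists>p\<ge>0. continuous (at_right p) h"
begin

lemma h_zero [simp]: "h 0 = 0"
  using goldie[of 0 0] by simp

lemma multiples_in_range:
  assumes "s \<ge> 0"
  shows "\<exists>u\<ge>0. h u = real n * h s"
proof (induction n)
  case 0
  show ?case by (intro exI[of _ 0]) simp
next
  case (Suc n)
  then obtain u where "u \<ge> 0" "h u = real n * h s" by blast
  then show ?case
    using goldie[OF assms, of u] g_nonneg[OF assms] assms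
    by (intro exI[of _ "s + g s * u"]) (simp add: algebra_simps)
qed

text \<open>By \<open>multiples_in_range\<close>, one nonzero value has all its natural multiples in
  the range.\<close>

lemma bounded_imp_zero:
  assumes bound: "\<And>u. u \<ge> 0 \<Longrightarrow> \<bar>h u\<bar> \<le> B" and "s \<ge> 0"
  shows "h s = 0"
proof (rule ccontr)
  assume "h s \<noteq> 0"
  then obtain n where n: "B < real n * \<bar>h s\<bar>"
    using reals_Archimedean3[of "\<bar>h s\<bar>"] by auto
  obtain u where "u \<ge> 0" "h u = real n * h s"
    using multiples_in_range[OF \<open>s \<ge> 0\<close>] by blast
  with bound[of u] n show False by (simp add: abs_mult)
qed

text \<open>If \<open>g s = 0\<close>, the equation reads \<open>h s = h s + h t\<close>.\<close>

lemma g_pos: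
  assumes "s \<ge> 0" "t \<ge> 0" "h t \<noteq> 0"
  shows "g s > 0"
proof (rule ccontr)
  assume "\<not> g s > 0"
  with g_nonneg[OF \<open>s \<ge> 0\<close>] have "g s = 0" by simp
  with goldie[OF assms(1,2)] \<open>h t \<noteq> 0\<close> show False by simp
qed

lemma diff_eq:
  assumes "0 \<le> s" "s \<le> u" "g s > 0"
  shows "h u - h s = h ((u - s) / g s)"
  using goldie[of s "(u - s) / g s"] assms by simp

lemma tendsto_zero_at_zero: "(h \<longlongrightarrow> 0) (at 0 within {0..})"
proof (cases "\<forall>t\<ge>0. h t = 0")
  case True
  then have "\<forall>\<^sub>F t in at 0 within {0..}. h t = 0"
    by (auto simp: eventually_at_filter)
  then show ?thesis by (rule tendsto_eventually)
next
  case False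
  then obtain t where t: "t \<ge> 0" "h t \<noteq> 0" by blast
  obtain p where p: "p \<ge> 0" "(h \<longlongrightarrow> h p) (at_right p)"
    using right_continuous by (auto simp: continuous_within)
  have gp: "g p > 0" using g_pos[OF p(1) t] .
  \<comment> \<open>Since \<open>g p > 0\<close>, this substitution carries the right limit at
    \<open>p\<close> back to 0, where the increment of \<open>h\<close> from \<open>p\<close> is
    \<open>h x\<close>.\<close>
  have "filterlim (\<lambda>x. p + g p * x) (at_right p) (at_right 0)"
  proof (rule filterlim_at_withinI)
    show "((\<lambda>x. p + g p * x) \<longlongrightarrow> p) (at_right 0)"
      by (auto intro!: tendsto_eq_intros)
    show "\<forall>\<^sub>F x in at_right 0. p + g p * x \<in> {p<..} - {p}"
      using gp by (auto simp: eventually_at_filter)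
  qed
  then have "((\<lambda>x. h (p + g p * x) - h p) \<longlongrightarrow> h p - h p) (at_right 0)"
    by (intro tendsto_intros filterlim_compose[OF p(2)])
  moreover have "\<forall>\<^sub>F x in at_right 0. h (p + g p * x) - h p = h x"
    using goldie[OF p(1)] by (auto simp: eventually_at_filter)
  ultimately have "(h \<longlongrightarrow> 0) (at_right 0)"
    using tendsto_cong by fastforce
  moreover have "at (0::real) within {0..} = at_right 0"
    by (metis at_within_Icc_at_right at_within_Ici_at_right)
  ultimately show ?thesis by simp
qed

lemma small_near_zero:
  assumes "e > 0"
  obtains d where "d > 0" "\<And>t. \<lbrakk>0 \<le> t; t < d\<rbrakk> \<Longrightarrow> \<bar>h t\<bar> < e"
proof -
  obtain d where d: "d > 0" "\<forall>x\<in>{0..}. 0 < dist x 0 \<and> dist x 0 < d \<longrightarrow> dist (h x) 0 < e"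
    using tendsto_zero_at_zero assms unfolding Lim_within by blast
  show thesis
  proof (rule that[OF d(1)])
    fix t :: real assume "0 \<le> t" "t < d"
    with d(2) assms show "\<bar>h t\<bar> < e" by (cases "t = 0") auto
  qed
qed

lemma g_ge_1:
  assumes "s \<ge> 0" "t \<ge> 0" "h t \<noteq> 0"
  shows "g s \<ge> 1"
proof (rule ccontr)
  assume "\<not> g s \<ge> 1"
  then have gs: "g s < 1" "g s > 0" using g_pos[OF assms] by auto
  \<comment> \<open>Solves \<open>s + g s * c = c\<close>.\<close>
  define c where "c = s / (1 - g s)"
  have c: "c \<ge> 0" "s + g s * c = c"
    using gs assms(1) by (auto simp: c_def field_simps)
  have "h s = 0" using goldie[OF assms(1) c(1)] c(2) by simp
  have gc: "g c > 0" using g_pos[OF c(1) assms(2,3)] .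
  \<comment> \<open>Each application of the contraction scales the distance to \<open>c\<close> by
    \<open>g s\<close> and adds \<open>h s = 0\<close> to the value.\<close>
  have iter: "h (c + g s ^ n * y) = h (c + y)" if "y \<ge> 0" for y n
  proof (induction n)
    case (Suc n)
    have "s + g s * (c + g s ^ n * y) = c + g s ^ Suc n * y"
      using c(2) by (simp add: algebra_simps)
    then show ?case
      using goldie[OF assms(1), of "c + g s ^ n * y"] Suc \<open>h s = 0\<close> c(1) gs that by simp
  qed simp
  \<comment> \<open>With this choice \<open>h (c + y) = h c + h t\<close>, so cancelling
    \<open>h c\<close> moves the invariance from \<open>c\<close> to 0. There it contradicts the
    limit 0, as \<open>g s ^ n * t\<close> tends to 0.\<close>
  define y where "y = g c * t"
  have y: "y \<ge> 0" using gc assms(2) by (simp add: y_def)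
  have const: "h (g s ^ n * t) = h t" for n
    using iter[OF y, of n] goldie[OF c(1), of "g s ^ n * t"] goldie[OF c(1) assms(2)] gs assms(2)
    by (simp add: y_def mult.left_commute)
  obtain d where d: "d > 0" "\<And>x. \<lbrakk>0 \<le> x; x < d\<rbrakk> \<Longrightarrow> \<bar>h x\<bar> < \<bar>h t\<bar>"
    using small_near_zero[of "\<bar>h t\<bar>"] assms(3) by auto
  have "(\<lambda>n. g s ^ n * t) \<longlonglongrightarrow> 0 * t"
    using gs by (intro tendsto_intros LIMSEQ_power_zero) auto
  then obtain n where "g s ^ n * t < d"
    using d(1) order_tendstoD(2)[of _ 0] eventually_happens'[OF sequentially_bot] by fastforce
  with d(2)[of "g s ^ n * t"] const[of n] gs assms(2) show False by simp
qed

lemma continuous_on_h: "continuous_on {0..} h"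
proof (cases "\<forall>t\<ge>0. h t = 0")
  case True
  then show ?thesis using continuous_on_cong[of "{0..}" "{0..}" h "\<lambda>_. 0"] by simp
next
  case False
  then obtain t where t: "t \<ge> 0" "h t \<noteq> 0" by blast
  have "uniformly_continuous_on {0..} h"
    unfolding uniformly_continuous_on_def
  proof (intro allI impI)
    fix e :: real assume "e > 0"
    then obtain d where d: "d > 0" "\<And>x. \<lbrakk>0 \<le> x; x < d\<rbrakk> \<Longrightarrow> \<bar>h x\<bar> < e"
      using small_near_zero by blast
    \<comment> \<open>Dividing by \<open>g s \<ge> 1\<close> only shrinks the increment, so one
      \<open>d\<close> serves every base point.\<close>
    have close: "\<bar>h u - h s\<bar> < e" if "0 \<le> s" "s \<le> u" "u - s < d" for s u
    proof -
      have g: "g s \<ge> 1" using g_ge_1[OF that(1) t] .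
      then have "(u - s) / g s \<le> u - s"
        using that(2) by (simp add: divide_le_eq mult_le_cancel_left1)
      then show ?thesis
        using diff_eq[OF that(1,2)] d(2)[of "(u - s) / g s"] g that by simp
    qed
    have "dist (h u) (h s) < e" if "s \<ge> 0" "u \<ge> 0" "dist u s < d" for s u
      using that close[of s u] close[of u s] by (cases "s \<le> u") (auto simp: dist_real_def)
    with d(1) show "\<exists>d>0. \<forall>s\<in>{0..}. \<forall>u\<in>{0..}. dist u s < d \<longrightarrow> dist (h u) (h s) < e"
      by auto
  qed
  then show ?thesis by (rule uniformly_continuous_imp_continuous)
qed

lemma h_nonzero:
  assumes "t \<ge> 0" "h t \<noteq> 0" "s > 0"
  shows "h s \<noteq> 0"
proof
  assume "h s = 0"
  have "compact (h ` {0..s})"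
    by (intro compact_continuous_image continuous_on_subset[OF continuous_on_h]) auto
  then obtain B where B: "\<And>u. u \<in> {0..s} \<Longrightarrow> \<bar>h u\<bar> \<le> B"
    using compact_imp_bounded bounded_real by (metis imageI)
  have g: "g s \<ge> 1" using g_ge_1[OF _ assms(1,2)] assms(3) by simp
  \<comment> \<open>Beyond the zero \<open>s\<close>, \<open>h u = h ((u - s) / g s)\<close>, and
    the new argument is at most \<open>u - s\<close>: one block of length \<open>s\<close> is
    removed.\<close>
  have bound: "\<bar>h u\<bar> \<le> B" if "0 \<le> u" "u \<le> real n * s" for u n
    using that
  proof (induction n arbitrary: u)
    case 0
    then show ?case using B[of u] assms(3) by simp
  next
    case (Suc n)
    show ?case
    proof (cases "u \<le> s")
      case True
      then show ?thesis using B Suc.prems by simp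
    next
      case False
      then have "(u - s) / g s \<le> u - s"
        using g by (simp add: divide_le_eq mult_le_cancel_left1)
      also have "\<dots> \<le> real n * s" using Suc.prems by (simp add: algebra_simps)
      finally have "\<bar>h ((u - s) / g s)\<bar> \<le> B" using Suc.IH False g by simp
      then show ?thesis using diff_eq[of s u] \<open>h s = 0\<close> False g assms(3) by simp
    qed
  qed
  have "\<bar>h u\<bar> \<le> B" if "u \<ge> 0" for u
    using bound[OF that] reals_Archimedean3[OF assms(3)] less_imp_le by blast
  from bounded_imp_zero[OF this assms(1)] assms(2) show False by simp
qed

text \<open>By \<open>diff_eq\<close>, two equal values would produce a positive zero.\<close>

lemma inj_on_h:
  assumes "t \<ge> 0" "h t \<noteq> 0"
  shows "inj_on h {0..}"
proof (rule linorder_inj_onI')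
  fix s u :: real assume "s \<in> {0..}" "u \<in> {0..}" "s < u"
  moreover from this have "g s > 0" using g_pos[OF _ assms] by simp
  ultimately show "h s \<noteq> h u"
    using diff_eq[of s u] h_nonzero[OF assms, of "(u - s) / g s"] by auto
qed

lemma g_affine:
  assumes "t \<ge> 0" "h t \<noteq> 0"
  obtains \<alpha> where "\<alpha> \<ge> 0" "\<And>s. s \<ge> 0 \<Longrightarrow> g s = \<alpha> * s + 1"
proof (rule that)
  show "0 \<le> g 1 - 1" using g_ge_1[OF _ assms, of 1] by simp
  fix s :: real assume s: "s \<ge> 0"
  \<comment> \<open>Comparing with the single point 1 already fixes the slope.\<close>
  have "h (s + g s * 1) = h (1 + g 1 * s)"
    using goldie[of s 1] goldie[of 1 s] s by simp
  then have "s + g s * 1 = 1 + g 1 * s"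
    using inj_onD[OF inj_on_h[OF assms]] s g_nonneg[of s] g_nonneg[of 1] by simp
  then show "g s = (g 1 - 1) * s + 1" by (simp add: algebra_simps)
qed

end

section \<open>Solving the scalar equation for constant and affine g\<close>

lemma additive_on_nonneg_imp_linear:
  fixes k :: "real \<Rightarrow> real"
  assumes add: "\<And>x y. \<lbrakk>x \<ge> 0; y \<ge> 0\<rbrakk> \<Longrightarrow> k (x + y) = k x + k y"
    and cont: "continuous_on {0..} k" and "x \<ge> 0"
  shows "k x = x * k 1"
proof -
  \<comment> \<open>The error against the linear candidate is additive and vanishes at 1, so it has
    period 1 and is bounded by its values on [0,1]. As an instance of \<open>goldie\<close> with
    constant 1, it must be zero.\<close>
  define d where "d y = k y - y * k 1" for y
  have cont_d: "continuous_on {0..} d"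
    unfolding d_def by (intro continuous_intros cont)
  then have "continuous (at_right 0) d"
    using continuous_within_subset[of 0 "{0..}" d "{0<..}"]
    by (simp add: continuous_on_eq_continuous_within subset_iff)
  then interpret d: goldie d "\<lambda>_. 1"
    by unfold_locales (auto simp: d_def add algebra_simps)
  have "compact (d ` {0..1})"
    by (intro compact_continuous_image continuous_on_subset[OF cont_d]) auto
  then obtain B where B: "\<And>y. y \<in> {0..1} \<Longrightarrow> \<bar>d y\<bar> \<le> B"
    using compact_imp_bounded bounded_real by (metis imageI)
  have "d 1 = 0" by (simp add: d_def)
  have shift: "d (y + real n) = d y" if "y \<ge> 0" for y n
  proof (induction n)
    case (Suc n)
    then show ?case
      using d.goldie[of "y + real n" 1] that \<open>d 1 = 0\<close> by (simp add: add_ac)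
  qed simp
  have "\<bar>d y\<bar> \<le> B" if "y \<ge> 0" for y
  proof -
    have "real (nat \<lfloor>y\<rfloor>) = of_int \<lfloor>y\<rfloor>" using that by simp
    then have "d y = d (frac y)"
      using shift[of "frac y" "nat \<lfloor>y\<rfloor>"] by (simp add: frac_def)
    then show ?thesis using B[of "frac y"] frac_ge_0[of y] frac_lt_1[of y] by simp
  qed
  from d.bounded_imp_zero[OF this \<open>x \<ge> 0\<close>] show ?thesis by (simp add: d_def)
qed

lemma goldie_const_imp_linear:
  assumes "goldie h g" and g: "\<And>s. s \<ge> 0 \<Longrightarrow> g s = 1" and "s \<ge> 0"
  shows "h s = s * h 1"
proof -
  interpret goldie h g by fact
  show ?thesis
    using goldie g continuous_on_h \<open>s \<ge> 0\<close>
    by (intro additive_on_nonneg_imp_linear) auto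
qed

lemma goldie_affine_imp_ln:
  assumes "goldie h g" and "\<alpha> > 0" and g: "\<And>s. s \<ge> 0 \<Longrightarrow> g s = \<alpha> * s + 1" and "s \<ge> 0"
  shows "h s = ln (\<alpha> * s + 1) * h ((exp 1 - 1) / \<alpha>)"
proof -
  interpret goldie h g by fact
  define k where "k x = h ((exp x - 1) / \<alpha>)" for x
  have add: "k (x + y) = k x + k y" if "x \<ge> 0" "y \<ge> 0" for x y
  proof -
    define a b where "a = (exp x - 1) / \<alpha>" and "b = (exp y - 1) / \<alpha>"
    have "a \<ge> 0" "b \<ge> 0" using that \<open>\<alpha> > 0\<close> by (auto simp: a_def b_def)
    \<comment> \<open>Here \<open>\<alpha> * a + 1 = exp x\<close>, so the operation becomes
      addition of exponents.\<close>
    moreover have "a + (\<alpha> * a + 1) * b = (exp (x + y) - 1) / \<alpha>"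
      using \<open>\<alpha> > 0\<close> by (simp add: a_def b_def exp_add field_simps)
    ultimately show ?thesis
      using goldie[of a b] g[of a] by (simp add: k_def a_def b_def)
  qed
  have "continuous_on {0..} k"
    unfolding k_def
    by (rule continuous_on_compose2[OF continuous_on_h])
      (use \<open>\<alpha> > 0\<close> in \<open>auto intro!: continuous_intros\<close>)
  then have "k (ln (\<alpha> * s + 1)) = ln (\<alpha> * s + 1) * k 1"
    using add \<open>\<alpha> > 0\<close> \<open>s \<ge> 0\<close> by (intro additive_on_nonneg_imp_linear) auto
  moreover have "\<alpha> * s + 1 > 0" using \<open>\<alpha> > 0\<close> \<open>s \<ge> 0\<close> by (simp add: add_nonneg_pos)
  ultimately show ?thesis using \<open>\<alpha> > 0\<close> by (simp add: k_def)
qed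

section \<open>From functionals back to vectors\<close>

lemma separates_points_eqI:
  assumes "separates_points D" "\<And>\<phi>. \<phi> \<in> D \<Longrightarrow> linear \<phi>" "\<And>\<phi>. \<phi> \<in> D \<Longrightarrow> \<phi> x = \<phi> y"
  shows "x = y"
proof (rule ccontr)
  assume "x \<noteq> y"
  then obtain \<phi> where "\<phi> \<in> D" "\<phi> (x - y) \<noteq> 0"
    using assms(1) unfolding separates_points_def by (metis right_minus_eq)
  with assms(2,3) show False by (simp add: linear_diff)
qed

theorem corollary3p10:
  fixes f :: "real \<Rightarrow> 'a::real_topological_vector" and g :: "real \<Rightarrow> real"
  assumes "separates_points (topological_dual :: ('a \<Rightarrow> real) set)"
    and "\<exists>s\<ge>0. f s \<noteq> 0"
    and "\<forall>\<phi>\<in>topological_dual. \<exists>p\<ge>0. continuous (at_right p) (\<lambda>s. \<phi> (f s))"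
    and "\<forall>s\<ge>0. g s \<ge> 0"
  shows "(\<forall>s\<ge>0. \<forall>t\<ge>0. f (s + g s * t) = f s + f t) \<longleftrightarrow>
    (\<exists>a. a \<noteq> 0 \<and> (\<forall>s\<ge>0. f s = s *\<^sub>R a) \<and> (\<forall>s\<ge>0. g s = 1)) \<or>
    (\<exists>\<alpha> a. \<alpha> > 0 \<and> a \<noteq> 0 \<and>
       (\<forall>s\<ge>0. f s = ln (\<alpha> * s + 1) *\<^sub>R a) \<and> (\<forall>s\<ge>0. g s = \<alpha> * s + 1))"
    (is "?eq \<longleftrightarrow> ?lin \<or> ?log")
proof
  assume eq: ?eq
  have linear: "linear \<phi>" if "\<phi> \<in> topological_dual" for \<phi> :: "'a \<Rightarrow> real"
    using that by (simp add: topological_dual_def)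
  have goldie: "goldie (\<lambda>s. \<phi> (f s)) g" if "\<phi> \<in> topological_dual" for \<phi>
    using assms(3,4) eq that by unfold_locales (auto simp: linear_add[OF linear])
  note f_eqI = separates_points_eqI[OF assms(1) linear]
  obtain t where t: "t \<ge> 0" "f t \<noteq> 0" using assms(2) by blast
  then obtain \<phi> :: "'a \<Rightarrow> real" where \<phi>: "\<phi> \<in> topological_dual" "\<phi> (f t) \<noteq> 0"
    using assms(1) unfolding separates_points_def by blast
  \<comment> \<open>A single functional not vanishing at \<open>f t\<close> determines
    \<open>g\<close>, hence the same \<alpha> serves all functionals.\<close>
  obtain \<alpha> where \<alpha>: "\<alpha> \<ge> 0" and g: "\<And>s. s \<ge> 0 \<Longrightarrow> g s = \<alpha> * s + 1"
    using goldie.g_affine[OF goldie[OF \<phi>(1)] t(1) \<phi>(2)] by blast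
  show "?lin \<or> ?log"
  proof (cases "\<alpha> = 0")
    case True
    define a where "a = f 1"
    have f: "f s = s *\<^sub>R a" if "s \<ge> 0" for s
      unfolding a_def using goldie_const_imp_linear[OF goldie _ that] g True
      by (intro f_eqI) (simp_all add: linear_cmul[OF linear])
    have "a \<noteq> 0" using f[OF t(1)] t(2) by auto
    with f g True show ?thesis by auto
  next
    case False
    with \<alpha> have "\<alpha> > 0" by simp
    \<comment> \<open>The value of \<open>f\<close> where the logarithm equals 1; it does not depend
      on the functional, so the scalar formulas combine into one for \<open>f\<close>.\<close>
    define a where "a = f ((exp 1 - 1) / \<alpha>)"
    have f: "f s = ln (\<alpha> * s + 1) *\<^sub>R a" if "s \<ge> 0" for s
      unfolding a_def using goldie_affine_imp_ln[OF goldie \<open>\<alpha> > 0\<close> g that]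
      by (intro f_eqI) (simp_all add: linear_cmul[OF linear])
    have "a \<noteq> 0" using f[OF t(1)] t(2) by auto
    with f g \<open>\<alpha> > 0\<close> show ?thesis by blast
  qed
next
  assume "?lin \<or> ?log"
  then show ?eq
  proof
    assume ?lin
    then show ?eq by (auto simp: scaleR_add_left)
  next
    assume ?log
    then obtain \<alpha> a where \<alpha>: "\<alpha> > 0" and f: "\<And>s. s \<ge> 0 \<Longrightarrow> f s = ln (\<alpha> * s + 1) *\<^sub>R a"
      and g: "\<And>s. s \<ge> 0 \<Longrightarrow> g s = \<alpha> * s + 1" by blast
    show ?eq
    proof (intro allI impI)
      fix s t :: real assume st: "s \<ge> 0" "t \<ge> 0"
      have pos: "\<alpha> * s + 1 > 0" "\<alpha> * t + 1 > 0"
        using \<alpha> st by (simp_all add: add_nonneg_pos)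
      \<comment> \<open>This factorization lets \<open>ln\<close> turn the product into the required
        sum.\<close>
      have "\<alpha> * (s + g s * t) + 1 = (\<alpha> * s + 1) * (\<alpha> * t + 1)"
        using g[OF st(1)] by (simp add: algebra_simps)
      moreover have "s + g s * t \<ge> 0" using assms(4) st by simp
      ultimately show "f (s + g s * t) = f s + f t"
        using f st pos by (simp add: ln_mult scaleR_add_left)
    qed
  qed
qed

end
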